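(* Let $G$ be a connected graph with at least two vertices such that $\gamma_t(G)\leq a(G)+1$, and let $G^{*}$ be the double graph of $G$. Then $\gamma_t(G^{*})\leq a(G^{*})+1$.
   Context: All graphs are finite and simple. $m(G)$ denotes the number of edges of $G$. A total dominating set of $G$ is a set $D\subseteq V(G)$ such that every vertex of $V(G)$ has a neighbor in $D$; the total domination number $\gamma_t(G)$ is the minimum cardinality of a total dominating set of $G$. If $d_1\leq d_2\leq\cdots\leq d_n$ is the ordered degree sequence of $G$, the annihilation number $a(G)$ is the largest integer $k$ with $k\le n$ such that $\sum_{i=1}^{k} d_i\leq m(G)$. The double graph $G^{*}$ of $G$ is constructed as follows: let $G_1$ and $G_2$ be disjoint copies of $G$, where for $u\in V(G)$ its copy in $G_i$, $i\in\{1,2\}$, is denoted $u_i$; then $G^{*}$ is obtained from the disjoint union of $G_1$ and $G_2$ by adding, for each edge $uv$ of $G$, the edges $u_1v_2$ and $u_2v_1$. *)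

theory Defs
  imports "Graph_Theory.Graph_Theory"
begin

text \<open>
  A finite simple graph is a \<^term>\<open>pair_graph\<close>: a finite, symmetric, loop-free digraph whose
  arcs are pairs of vertices. An edge \<open>uv\<close> is the pair of arcs \<open>(u,v)\<close> and \<open>(v,u)\<close>; hence the
  degree of a vertex is its out-degree, whereas \<open>num_edges\<close> has to count unordered pairs.
\<close>

definition num_edges :: "'a pair_pre_digraph \<Rightarrow> nat" where
  "num_edges G = card {{u, v} | u v. (u, v) \<in> parcs G}"

definition total_dominating_set :: "'a pair_pre_digraph \<Rightarrow> 'a set \<Rightarrow> bool" where
  "total_dominating_set G D \<longleftrightarrow>
     D \<subseteq> pverts G \<and> (\<forall>v \<in> pverts G. \<exists>w \<in> D. (v, w) \<in> parcs G)"

text \<open>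
  Graphs with isolated vertices have no total dominating set; the value is then the unspecified
  minimum of the empty set.
\<close>

definition total_domination_number :: "'a pair_pre_digraph \<Rightarrow> nat" where
  "total_domination_number G = Min {card D | D. total_dominating_set G D}"

definition degree_sequence :: "'a pair_pre_digraph \<Rightarrow> nat list" where
  "degree_sequence G =
     sorted_list_of_multiset (image_mset (out_degree (with_proj G)) (mset_set (pverts G)))"

definition annihilation_number :: "'a pair_pre_digraph \<Rightarrow> nat" where
  "annihilation_number G =
     Max {k. k \<le> card (pverts G) \<and> (\<Sum>i<k. degree_sequence G ! i) \<le> num_edges G}"

text \<open>
  The vertices \<open>Inl u\<close> and \<open>Inr u\<close> are the two copies of \<open>u\<close>.
\<close>

definition double_graph :: "'a pair_pre_digraph \<Rightarrow> ('a + 'a) pair_pre_digraph" where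
  "double_graph G =
     \<lparr> pverts = pverts G <+> pverts G,
       parcs = {(Inl u, Inl v) | u v. (u, v) \<in> parcs G} \<union> {(Inr u, Inr v) | u v. (u, v) \<in> parcs G}
             \<union> {(Inl u, Inr v) | u v. (u, v) \<in> parcs G} \<union> {(Inr u, Inl v) | u v. (u, v) \<in> parcs G} \<rparr>"

lemma pair_graph_double_graph:
  assumes "pair_graph G"
  shows "pair_graph (double_graph G)"
proof -
  interpret pair_graph G by fact
  have sub: "parcs (double_graph G) \<subseteq> pverts (double_graph G) \<times> pverts (double_graph G)"
    by (auto simp: double_graph_def intro: wellformed')
  have fin: "finite (pverts (double_graph G))"
    by (simp add: double_graph_def pair_finite_verts)
  show ?thesis
  proof
    show "finite (pverts (double_graph G))"
      by (rule fin)
    show "finite (parcs (double_graph G))"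
      using sub fin by (rule finite_subset[OF _ finite_cartesian_product]) (rule fin)
    show "symmetric (with_proj (double_graph G))"
      by (auto simp: symmetric_def double_graph_def intro!: symI dest: arcs_symmetric)
    show "fst e \<in> pverts (double_graph G)" "snd e \<in> pverts (double_graph G)"
      if "e \<in> parcs (double_graph G)" for e
      using that sub by auto
    show "fst e \<noteq> snd e" if "e \<in> parcs (double_graph G)" for e
      using that by (auto simp: double_graph_def dest: no_loops')
  qed
qed

lemma length_degree_sequence: "length (degree_sequence G) = card (pverts G)"
  by (metis degree_sequence_def mset_sorted_list_of_multiset size_image_mset size_mset
      size_mset_set)

text \<open>
  The sets whose minimum and maximum define the two graph invariants are finite and nonempty.
\<close>

lemma total_domination_set_well_defined:
  assumes "pair_graph G" and "connected (with_proj G)" and "card (pverts G) \<ge> 2"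
  shows "finite {card D | D. total_dominating_set G D}"
    and "{card D | D. total_dominating_set G D} \<noteq> {}"
proof -
  interpret pair_graph G by fact
  have "{card D | D. total_dominating_set G D} \<subseteq> card ` Pow (pverts G)"
    by (auto simp: total_dominating_set_def)
  then show "finite {card D | D. total_dominating_set G D}"
    by (rule finite_subset) (simp add: pair_finite_verts)
  have "\<exists>w \<in> pverts G. (v, w) \<in> parcs G" if v: "v \<in> pverts G" for v
  proof -
    obtain u where u: "u \<in> pverts G" "u \<noteq> v"
      using assms(3) v by (metis One_nat_def card.empty card_Suc_eq is_singletonI'
          is_singleton_altdef empty_iff not_less_eq_eq numeral_2_eq_2 order_refl)
    have "v \<rightarrow>\<^sup>*\<^bsub>mk_symmetric G\<^esub> u"
      using assms(2) u v by (simp add: connected_def strongly_connected_def)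
    then have "v \<rightarrow>\<^sup>*\<^bsub>with_proj G\<^esub> u"
      using reachable_mk_symmetric_eq sym_arcs by simp
    then have "(v, u) \<in> (parcs G)\<^sup>*"
      using reachable_rtranclI by fastforce
    with u(2) show ?thesis
      by (metis converse_rtranclE in_arcsD2)
  qed
  then have "total_dominating_set G (pverts G)"
    by (simp add: total_dominating_set_def)
  then show "{card D | D. total_dominating_set G D} \<noteq> {}"
    by blast
qed

lemma annihilation_set_well_defined:
  shows "finite {k. k \<le> card (pverts G) \<and> (\<Sum>i<k. degree_sequence G ! i) \<le> num_edges G}"
    and "0 \<in> {k. k \<le> card (pverts G) \<and> (\<Sum>i<k. degree_sequence G ! i) \<le> num_edges G}"
  by simp_all

end

theory Submission
  imports Defs
begin

text \<open>
  Let \<open>G\<^sup>*\<close> be the double graph of \<open>G\<close>. Doubling a graph does not increase its total domination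
  number and at least doubles its annihilation number, so that
  \<open>\<gamma>\<^sub>t(G\<^sup>*) \<le> \<gamma>\<^sub>t(G) \<le> a(G) + 1 \<le> 2 a(G) + 1 \<le> a(G\<^sup>*) + 1\<close>.

  The first inequality holds because the copies of a neighbour of \<open>u\<close> are adjacent to both copies
  of \<open>u\<close>: one copy of a total dominating set of \<open>G\<close> dominates all of \<open>G\<^sup>*\<close>
  (\<open>total_domination_number_double_graph_le\<close>). For the last one, every vertex of degree \<open>d\<close> gives
  rise to two vertices of degree \<open>2 d\<close>, so the \<open>2 k\<close> smallest degrees of \<open>G\<^sup>*\<close> add up to four
  times the sum of the \<open>k\<close> smallest degrees of \<open>G\<close>; and \<open>G\<^sup>*\<close> has four times as many
  edges as \<open>G\<close> (\<open>annihilation_number_double_graph_ge\<close>).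
\<close>

lemma total_dominating_set_double_graph:
  assumes "total_dominating_set G D"
  shows "total_dominating_set (double_graph G) (Inl ` D)"
proof -
  have "\<exists>x \<in> Inl ` D. (y, x) \<in> parcs (double_graph G)"
    if y: "y \<in> pverts (double_graph G)" for y
  proof -
    obtain v where v: "v \<in> pverts G" "y = Inl v \<or> y = Inr v"
      using y by (auto simp: double_graph_def)
    obtain w where "w \<in> D" "(v, w) \<in> parcs G"
      using assms v(1) by (auto simp: total_dominating_set_def)
    with v(2) show ?thesis
      by (intro bexI[of _ "Inl w"]) (auto simp: double_graph_def)
  qed
  moreover have "Inl ` D \<subseteq> pverts (double_graph G)"
    using assms by (auto simp: total_dominating_set_def double_graph_def)
  ultimately show ?thesis
    by (simp add: total_dominating_set_def)
qed

lemma finite_card_total_dominating_sets: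
  assumes "finite (pverts G)"
  shows "finite {card D | D. total_dominating_set G D}"
proof (rule finite_subset)
  show "{card D | D. total_dominating_set G D} \<subseteq> card ` Pow (pverts G)"
    by (auto simp: total_dominating_set_def)
qed (simp add: assms)

text \<open>
  The existence of a total dominating set is assumed because \<^const>\<open>total_domination_number\<close> is
  unspecified without one.
\<close>

lemma total_domination_number_double_graph_le:
  assumes "finite (pverts G)" and "total_dominating_set G D\<^sub>0"
  shows "total_domination_number (double_graph G) \<le> total_domination_number G"
proof -
  have "total_domination_number G \<in> {card D | D. total_dominating_set G D}"
    unfolding total_domination_number_def
    using assms by (intro Min_in finite_card_total_dominating_sets) auto
  then obtain D where D: "total_dominating_set G D" "card D = total_domination_number G"
    by auto
  have "total_domination_number (double_graph G) \<le> card (Inl ` D :: ('a + 'a) set)"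
    unfolding total_domination_number_def
  proof (rule Min_le)
    show "finite {card D | D. total_dominating_set (double_graph G) D}"
      using assms(1) by (intro finite_card_total_dominating_sets) (simp add: double_graph_def)
  qed (use total_dominating_set_double_graph[OF D(1)] in blast)
  also have "\<dots> = total_domination_number G"
    using D(2) by (simp add: card_image)
  finally show ?thesis .
qed

lemma parcs_double_graph:
  "parcs (double_graph G) =
     map_prod Inl Inl ` parcs G \<union> map_prod Inr Inr ` parcs G \<union>
     map_prod Inl Inr ` parcs G \<union> map_prod Inr Inl ` parcs G"
proof -
  have "{(f u, g v) | u v. (u, v) \<in> parcs G} = map_prod f g ` parcs G"
    for f g :: "'a \<Rightarrow> 'a + 'a"
    by force
  then show ?thesis
    by (simp add: double_graph_def)
qed

lemma card_parcs_double_graph: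
  assumes "finite (parcs G)"
  shows "card (parcs (double_graph G)) = 4 * card (parcs G)"
proof -
  have inj: "inj_on (map_prod f g) (parcs G)" if "inj f" "inj g"
    for f g :: "'a \<Rightarrow> 'a + 'a"
    using prod.inj_map[OF that] by (rule inj_on_subset) simp
  show ?thesis
    unfolding parcs_double_graph
    by (subst card_Un_disjoint, simp add: assms, simp add: assms, force)+
       (simp add: card_image inj)
qed

lemma arcs_over_doubleton:
  assumes "(u, v) \<in> A" and "(v, u) \<in> A"
  shows "{a \<in> A. (case a of (x, y) \<Rightarrow> {x, y}) = {u, v}} = {(u, v), (v, u)}"
proof (rule set_eqI)
  fix a
  show "a \<in> {a \<in> A. (case a of (x, y) \<Rightarrow> {x, y}) = {u, v}} \<longleftrightarrow> a \<in> {(u, v), (v, u)}"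
    using assms
    by (cases a) (auto simp only: doubleton_eq_iff mem_Collect_eq prod.case insert_iff empty_iff
        prod.inject)
qed

text \<open>
  Sending an arc to its underlying edge is two-to-one, since arcs come in opposite pairs and there
  are no loops. Through this identity, edges are counted by counting arcs.
\<close>

lemma card_parcs_eq_twice_num_edges:
  assumes "pair_graph G"
  shows "card (parcs G) = 2 * num_edges G"
proof -
  interpret pair_graph G by fact
  let ?edge = "\<lambda>(u, v). {u, v}"
  have edges: "{{u, v} | u v. (u, v) \<in> parcs G} = ?edge ` parcs G"
    by force
  have fibre: "card {a \<in> parcs G. ?edge a = e} = 2" if "e \<in> ?edge ` parcs G" for e
  proof -
    obtain u v where uv: "(u, v) \<in> parcs G" "e = {u, v}"
      using \<open>e \<in> ?edge ` parcs G\<close> by auto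
    have "{a \<in> parcs G. ?edge a = e} = {(u, v), (v, u)}"
      unfolding uv(2) using uv(1) arcs_symmetric[OF uv(1)] by (rule arcs_over_doubleton)
    moreover have "u \<noteq> v"
      using no_loops'[of u] uv(1) by metis
    ultimately show ?thesis
      by simp
  qed
  have "card (parcs G) = (\<Sum>e \<in> ?edge ` parcs G. card {a \<in> parcs G. ?edge a = e})"
    using sum.image_gen[of "parcs G" "\<lambda>_. 1 :: nat" ?edge] pair_finite_arcs by simp
  also have "\<dots> = 2 * card (?edge ` parcs G)"
    using fibre by simp
  finally show ?thesis
    by (simp add: num_edges_def edges)
qed

lemma num_edges_double_graph:
  assumes "pair_graph G"
  shows "num_edges (double_graph G) = 4 * num_edges G"
proof -
  interpret pair_graph G by fact
  show ?thesis
    using card_parcs_double_graph[OF pair_finite_arcs]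
      card_parcs_eq_twice_num_edges[OF assms]
      card_parcs_eq_twice_num_edges[OF pair_graph_double_graph[OF assms]]
    by simp
qed

lemma out_degree_with_proj:
  "out_degree (with_proj G) v = card {w. (v, w) \<in> parcs G}"
proof -
  have "out_arcs (with_proj G) v = Pair v ` {w. (v, w) \<in> parcs G}"
    by (auto simp: out_arcs_def)
  then show ?thesis
    by (simp add: out_degree_def card_image inj_on_def)
qed

lemma out_degree_double_graph:
  assumes "finite (parcs G)" and "x = Inl v \<or> x = Inr v"
  shows "out_degree (with_proj (double_graph G)) x = 2 * out_degree (with_proj G) v"
proof -
  let ?N = "{w. (v, w) \<in> parcs G}"
  have "?N = snd ` {a \<in> parcs G. fst a = v}"
    by force
  then have "finite ?N"
    using assms(1) by simp
  moreover have "{y. (x, y) \<in> parcs (double_graph G)} = ?N <+> ?N"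
    using assms(2) by (auto simp: double_graph_def)
  ultimately show ?thesis
    by (simp add: out_degree_with_proj card_Plus)
qed

lemma sorted_concat_map_pair:
  assumes "sorted xs" and "mono f"
  shows "sorted (concat (map (\<lambda>x. [f x, f x]) xs))"
  using assms by (induction xs) (auto dest: monoD)

lemma mset_concat_map_pair:
  "mset (concat (map (\<lambda>x. [f x, f x]) xs)) = image_mset f (mset xs) + image_mset f (mset xs)"
  by (induction xs) auto

lemma sum_nth_concat_map_pair:
  fixes f :: "'a \<Rightarrow> 'b::comm_semiring_1"
  assumes "k \<le> length xs"
  shows "(\<Sum>i<2 * k. concat (map (\<lambda>x. [f x, f x]) xs) ! i) = 2 * (\<Sum>i<k. f (xs ! i))"
  using assms
proof (induction xs arbitrary: k)
  case (Cons x xs)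
  show ?case
  proof (cases k)
    case (Suc j)
    with Cons show ?thesis
      by (simp add: sum.lessThan_Suc_shift distrib_left mult_2 del: sum.lessThan_Suc)
         (simp add: ac_simps)
  qed simp
qed simp

text \<open>
  Doubling preserves the order of the degrees, so no re-sorting is needed: both sides are sorted
  lists with the same entries.
\<close>

lemma degree_sequence_double_graph:
  assumes "pair_graph G"
  shows "degree_sequence (double_graph G) =
           concat (map (\<lambda>d. [2 * d, 2 * d]) (degree_sequence G))"
proof -
  interpret pair_graph G by fact
  let ?V = "mset_set (pverts G)"
  let ?deg = "out_degree (with_proj G)"
  let ?deg' = "out_degree (with_proj (double_graph G))"
  have "mset_set (pverts (double_graph G)) = image_mset Inl ?V + image_mset Inr ?V"
    unfolding double_graph_def Plus_def
    using pair_finite_verts by (simp, subst mset_set_Union) (auto simp: image_mset_mset_set)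
  then have "mset (degree_sequence (double_graph G)) =
      image_mset (?deg' \<circ> Inl) ?V + image_mset (?deg' \<circ> Inr) ?V"
    by (simp add: degree_sequence_def multiset.map_comp)
  also have "\<dots> = image_mset (\<lambda>v. 2 * ?deg v) ?V + image_mset (\<lambda>v. 2 * ?deg v) ?V"
    by (simp add: comp_def out_degree_double_graph pair_finite_arcs)
  also have "\<dots> = mset (concat (map (\<lambda>d. [2 * d, 2 * d]) (degree_sequence G)))"
    unfolding mset_concat_map_pair
    by (simp add: degree_sequence_def multiset.map_comp comp_def)
  finally have mset_eq: "mset (degree_sequence (double_graph G)) =
      mset (concat (map (\<lambda>d. [2 * d, 2 * d]) (degree_sequence G)))" .
  have "sorted (degree_sequence G)" "sorted (degree_sequence (double_graph G))"
    by (simp_all add: degree_sequence_def)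
  moreover from this(1)
  have "sorted (concat (map (\<lambda>d. [2 * d, 2 * d]) (degree_sequence G)))"
    by (rule sorted_concat_map_pair) (simp add: mono_def)
  ultimately show ?thesis
    using properties_for_sort[OF mset_eq] by (simp add: sorted_sort_id)
qed

lemma annihilation_number_double_graph_ge:
  assumes "pair_graph G"
  shows "2 * annihilation_number G \<le> annihilation_number (double_graph G)"
proof -
  interpret pair_graph G by fact
  let ?a = "annihilation_number G"
  have "?a \<in> {k. k \<le> card (pverts G) \<and> (\<Sum>i<k. degree_sequence G ! i) \<le> num_edges G}"
    unfolding annihilation_number_def
    using annihilation_set_well_defined[of G] by (intro Max_in) auto
  then have a: "?a \<le> card (pverts G)" "(\<Sum>i<?a. degree_sequence G ! i) \<le> num_edges G"
    by auto
  have "2 * ?a \<le> card (pverts (double_graph G))"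
    using a(1) by (simp add: double_graph_def card_Plus pair_finite_verts)
  moreover have "(\<Sum>i<2 * ?a. degree_sequence (double_graph G) ! i) =
      4 * (\<Sum>i<?a. degree_sequence G ! i)"
    using a(1) by (simp add: degree_sequence_double_graph[OF assms] sum_nth_concat_map_pair
        length_degree_sequence flip: sum_distrib_left)
  then have "(\<Sum>i<2 * ?a. degree_sequence (double_graph G) ! i) \<le> num_edges (double_graph G)"
    using a(2) by (simp add: num_edges_double_graph[OF assms])
  ultimately show ?thesis
    unfolding annihilation_number_def[of "double_graph G"]
    using annihilation_set_well_defined(1)[of "double_graph G"] by (intro Max_ge) auto
qed

theorem proposition3p2:
  fixes G :: "'a pair_pre_digraph"
  assumes "pair_graph G"
    and "connected (with_proj G)"
    and "card (pverts G) \<ge> 2"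
    and "total_domination_number G \<le> annihilation_number G + 1"
  shows "total_domination_number (double_graph G) \<le> annihilation_number (double_graph G) + 1"
proof -
  interpret pair_graph G by fact
  obtain D\<^sub>0 where "total_dominating_set G D\<^sub>0"
    using total_domination_set_well_defined(2)[OF assms(1-3)] by auto
  then have "total_domination_number (double_graph G) \<le> total_domination_number G"
    by (rule total_domination_number_double_graph_le[OF pair_finite_verts])
  also note assms(4)
  also have "annihilation_number G + 1 \<le> annihilation_number (double_graph G) + 1"
    using annihilation_number_double_graph_ge[OF assms(1)] by simp
  finally show ?thesis .
qed

end
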